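(* Let $A \in \mathbb{C}^{n\times n}$ and let $k$ be an integer with $0 \leq k \leq n$. Then $A \in \mathcal{U}_k$ if and only if $A$ has at most $k$ singular values strictly greater than $1$ and at most $k$ singular values strictly smaller than $1$.
   Context: $\mathcal{U}_k$ is the set of unitary-plus-rank-$k$ matrices: $A\in\mathbb{C}^{n\times n}$ belongs to $\mathcal{U}_k$ if and only if there exist a unitary matrix $Q\in\mathbb{C}^{n\times n}$ and matrices $G,B\in\mathbb{C}^{n\times k}$ such that $A = Q + GB^*$. Singular values are counted with multiplicity; an $n\times n$ matrix has $n$ singular values. *)

theory Defs
  imports
    "HOL-Computational_Algebra.Fundamental_Theorem_Algebra"
    "Jordan_Normal_Form.Schur_Decomposition"
begin

definition unitary_mat :: "complex mat \<Rightarrow> bool" where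
  "unitary_mat Q \<longleftrightarrow> square_mat Q \<and>
     mat_adjoint Q * Q = 1\<^sub>m (dim_row Q) \<and> Q * mat_adjoint Q = 1\<^sub>m (dim_row Q)"

definition unitary_plus_rank :: "nat \<Rightarrow> nat \<Rightarrow> complex mat set" where
  "unitary_plus_rank n k = {A. \<exists>Q G B.
     Q \<in> carrier_mat n n \<and> unitary_mat Q \<and>
     G \<in> carrier_mat n k \<and> B \<in> carrier_mat n k \<and>
     A = Q + G * mat_adjoint B}"

text \<open>The roots of the characteristic polynomial of \<open>A\<^sup>* A\<close>, taken with multiplicity, are
  nonnegative reals (\<open>char_poly_gram_root\<close> below), so taking the real part merely changes
  the type. A matrix with \<open>n\<close> columns therefore gets exactly \<open>n\<close> singular values; this is
  the intended notion for square matrices, the only case used here.\<close>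

definition singular_values :: "complex mat \<Rightarrow> real multiset" where
  "singular_values A =
     image_mset (\<lambda>e. sqrt (Re e)) (proots (char_poly (mat_adjoint A * A)))"

lemma mat_adjoint_carrier:
  assumes "A \<in> carrier_mat m n"
  shows "mat_adjoint A \<in> carrier_mat n m"
  using assms unfolding mat_adjoint_def carrier_mat_def by simp

lemma mat_adjoint_index:
  assumes "A \<in> carrier_mat m n" "i < n" "j < m"
  shows "mat_adjoint A $$ (i, j) = conjugate (A $$ (j, i))"
  using assms unfolding mat_adjoint_def carrier_mat_def by (simp add: mat_of_rows_def)

lemma size_singular_values:
  assumes "A \<in> carrier_mat m n"
  shows "size (singular_values A) = n"
proof -
  have "mat_adjoint A * A \<in> carrier_mat n n"
    using assms mat_adjoint_carrier[OF assms] by simp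
  then show ?thesis
    unfolding singular_values_def by (simp add: size_proots_complex degree_monic_char_poly)
qed

lemma mat_adjoint_scalar_prod:
  fixes A :: "complex mat"
  assumes A: "A \<in> carrier_mat m n" and v: "v \<in> carrier_vec n" and w: "w \<in> carrier_vec m"
  shows "(mat_adjoint A *\<^sub>v w) \<bullet>c v = w \<bullet>c (A *\<^sub>v v)"
proof -
  note B = mat_adjoint_carrier[OF A]
  have "(mat_adjoint A *\<^sub>v w) \<bullet>c v
      = (\<Sum>i<n. (\<Sum>j<m. cnj (A $$ (j, i)) * w $ j) * cnj (v $ i))"
    using A B v w
    by (auto simp: scalar_prod_def mat_adjoint_index[OF A] lessThan_atLeast0 intro!: sum.cong)
  also have "\<dots> = (\<Sum>j<m. w $ j * (\<Sum>i<n. cnj (A $$ (j, i)) * cnj (v $ i)))"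
    by (simp add: sum_distrib_left sum_distrib_right sum.swap[of _ "{..<n}"] mult_ac)
  also have "\<dots> = w \<bullet>c (A *\<^sub>v v)"
    using A v w by (auto simp: scalar_prod_def lessThan_atLeast0 intro!: sum.cong)
  finally show ?thesis .
qed

lemma char_poly_gram_root:
  assumes A: "A \<in> carrier_mat m n"
    and e: "e \<in># proots (char_poly (mat_adjoint A * A))"
  shows "e \<in> \<real>" and "0 \<le> Re e"
proof -
  let ?M = "mat_adjoint A * A"
  note B = mat_adjoint_carrier[OF A]
  have M: "?M \<in> carrier_mat n n" using A B by simp
  have "char_poly ?M \<noteq> 0" using degree_monic_char_poly[OF M] by auto
  with e have "poly (char_poly ?M) e = 0" by simp
  then have "eigenvalue ?M e" using eigenvalue_root_char_poly[OF M] by simp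
  then obtain v where v: "v \<in> carrier_vec n" "v \<noteq> 0\<^sub>v n" and ev: "?M *\<^sub>v v = e \<cdot>\<^sub>v v"
    using M unfolding eigenvalue_def eigenvector_def by auto
  have "e * (v \<bullet>c v) = (?M *\<^sub>v v) \<bullet>c v"
    using v by (simp add: ev)
  also have "\<dots> = (A *\<^sub>v v) \<bullet>c (A *\<^sub>v v)"
    using mat_adjoint_scalar_prod[OF A v(1), of "A *\<^sub>v v"] A B v by simp
  finally have eq: "e * (v \<bullet>c v) = (A *\<^sub>v v) \<bullet>c (A *\<^sub>v v)" .
  have "0 < v \<bullet>c v" using v conjugate_square_greater_0_vec by blast
  moreover have "0 \<le> (A *\<^sub>v v) \<bullet>c (A *\<^sub>v v)" by (rule conjugate_square_ge_0_vec)
  ultimately have "Im e = 0 \<and> 0 \<le> Re e"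
    unfolding eq[symmetric] by (auto simp: less_eq_complex_def less_complex_def zero_le_mult_iff)
  then show "e \<in> \<real>" and "0 \<le> Re e" by (auto simp: complex_is_Real_iff)
qed

end

theory Submission
  imports Defs
begin

text \<open>
  The square of the norm of \<open>A x\<close> exceeds that of \<open>x\<close> by the value at \<open>x\<close> of the Hermitian form of
  \<open>H = A\<^sup>* A - 1\<close>. An orthonormal eigenbasis of \<open>A\<^sup>* A\<close> diagonalises \<open>H\<close>, and its positive and negative
  diagonal entries count the singular values above and below \<open>1\<close>. Being unitary plus rank \<open>k\<close>
  means being isometric on a subspace of dimension \<open>n - k\<close>, that is, the form of \<open>H\<close> vanishes on
  such a subspace. Thus the theorem says how large an isotropic subspace of a Hermitian form of
  given inertia can be.

  Necessity is a dimension count. If \<open>A = Q + G B\<^sup>*\<close>, then \<open>A\<close> agrees with \<open>Q\<close> on the kernel of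
  \<open>B\<^sup>*\<close>, which meets nontrivially every subspace of dimension greater than \<open>k\<close>. Hence no such
  subspace can be spanned by eigenvectors of \<open>A\<^sup>* A\<close> whose eigenvalues all exceed \<open>1\<close>, or all
  lie below \<open>1\<close>
  (\<open>unitary_plus_rank_eigenvalues\<close>).

  For sufficiency, sort the eigenvalues \<open>\<mu> 0 \<le> \<dots> \<le> \<mu> (n - 1)\<close>. The first \<open>n - k\<close> are at most \<open>1\<close>
  and the last \<open>n - k\<close> are at least \<open>1\<close>. The eigenvectors shared by the two groups have
  eigenvalue \<open>1\<close>; each of the others in the first group is paired with one in the second. In the
  plane of a pair a suitable unit vector is isotropic (\<open>convex_combination_to_one\<close>), and different
  pairs are orthogonal for the inner product and for the form
  (\<open>orthonormal_pair_combinations\<close>). This gives \<open>n - k\<close> orthonormal vectors with orthonormal images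
  under \<open>A\<close>. Completing both families to bases defines a unitary \<open>Q\<close> that agrees with \<open>A\<close> on the
  first family, so \<open>A - Q\<close> factors through the remaining \<open>k\<close> coordinates
  (\<open>unitary_plus_rank_if_isometric_on\<close>).
\<close>

section \<open>Underdetermined systems and adjoints\<close>

text \<open>
  Padding the system with zero rows makes it square and singular. The dimension count serves
  both to complete orthonormal families and to intersect subspaces.
\<close>
lemma homogeneous_system_nontrivial:
  fixes F :: "'a :: idom mat"
  assumes F: "F \<in> carrier_mat k p" and "k < p"
  obtains z where "z \<in> carrier_vec p" "z \<noteq> 0\<^sub>v p" "F *\<^sub>v z = 0\<^sub>v k"
proof -
  define S where "S = mat\<^sub>r p p (\<lambda>i. if i = p - 1 then 0\<^sub>v p else if i < k then row F i else 0\<^sub>v p)"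
  have S: "S \<in> carrier_mat p p" by (simp add: S_def)
  have "det S = 0" unfolding S_def
    by (rule det_row_0) (use assms in auto)
  then obtain z where z: "z \<in> carrier_vec p" "z \<noteq> 0\<^sub>v p" "S *\<^sub>v z = 0\<^sub>v p"
    using det_0_iff_vec_prod_zero[OF S] by auto
  have "F *\<^sub>v z = 0\<^sub>v k"
  proof (rule eq_vecI)
    fix r assume "r < dim_vec (0\<^sub>v k :: 'a vec)"
    then have r: "r < k" by simp
    then have "r \<noteq> p - 1" using \<open>k < p\<close> by linarith
    then have "row S r = row F r" using r assms by (simp add: S_def)
    then have "(F *\<^sub>v z) $ r = (S *\<^sub>v z) $ r" using r assms S by simp
    then show "(F *\<^sub>v z) $ r = 0\<^sub>v k $ r" using z r assms by simp
  qed (use F in simp)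
  with z show ?thesis using that by blast
qed

lemma mat_adjoint_mult:
  assumes A: "A \<in> carrier_mat m n" and B: "(B :: complex mat) \<in> carrier_mat n p"
  shows "mat_adjoint (A * B) = mat_adjoint B * mat_adjoint A"
  using A B mat_adjoint_carrier[OF A] mat_adjoint_carrier[OF B]
    mat_adjoint_carrier[OF mult_carrier_mat[OF A B]]
  by (intro eq_matI)
    (auto simp: mat_adjoint_index[OF A] mat_adjoint_index[OF B]
      mat_adjoint_index[OF mult_carrier_mat[OF A B]] scalar_prod_def mult.commute intro!: sum.cong)

lemma mat_adjoint_adjoint:
  assumes A: "(A :: complex mat) \<in> carrier_mat m n"
  shows "mat_adjoint (mat_adjoint A) = A"
  using A mat_adjoint_carrier[OF A] mat_adjoint_carrier[OF mat_adjoint_carrier[OF A]]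
  by (intro eq_matI)
    (auto simp: mat_adjoint_index[OF A] mat_adjoint_index[OF mat_adjoint_carrier[OF A]])

lemma mat_adjoint_scalar_prod_right:
  fixes A :: "complex mat"
  assumes A: "A \<in> carrier_mat m n" and v: "v \<in> carrier_vec n" and w: "w \<in> carrier_vec m"
  shows "(A *\<^sub>v v) \<bullet>c w = v \<bullet>c (mat_adjoint A *\<^sub>v w)"
  using mat_adjoint_scalar_prod[OF mat_adjoint_carrier[OF A] w v]
  by (simp add: mat_adjoint_adjoint[OF A])

lemma unitary_mat_mult:
  assumes P: "P \<in> carrier_mat n n" "unitary_mat P" and R: "R \<in> carrier_mat n n" "unitary_mat R"
  shows "unitary_mat (P * R)"
proof -
  note P' = mat_adjoint_carrier[OF P(1)] and R' = mat_adjoint_carrier[OF R(1)]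
  have p: "mat_adjoint P * P = 1\<^sub>m n" "mat_adjoint R * R = 1\<^sub>m n"
    using P R by (auto simp: unitary_mat_def)
  have "mat_adjoint (P * R) * (P * R) = mat_adjoint R * (mat_adjoint P * P) * R"
    using P R P' R' unfolding mat_adjoint_mult[OF P(1) R(1)]
    by (simp add: assoc_mult_mat[of _ n n _ n _ n])
  also have "\<dots> = 1\<^sub>m n" using p R' by simp
  finally have l: "mat_adjoint (P * R) * (P * R) = 1\<^sub>m n" .
  have PR: "P * R \<in> carrier_mat n n" using P R by simp
  have "(P * R) * mat_adjoint (P * R) = 1\<^sub>m n"
    by (rule mat_mult_left_right_inverse[OF mat_adjoint_carrier[OF PR] PR l])
  with l PR P(1) R(1) show ?thesis by (auto simp: unitary_mat_def)
qed

lemma unitary_mat_adjoint: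
  assumes P: "P \<in> carrier_mat n n" "unitary_mat P"
  shows "unitary_mat (mat_adjoint P)"
  using P mat_adjoint_carrier[OF P(1)]
  by (auto simp: unitary_mat_def mat_adjoint_adjoint[OF P(1)])

section \<open>Orthonormal families\<close>

text \<open>
  Families are indexed by natural numbers and only their first \<open>m\<close> members are constrained, so
  that a family is prolonged by a function update at \<open>m\<close>.
\<close>
definition orthonormal :: "nat \<Rightarrow> nat \<Rightarrow> (nat \<Rightarrow> complex vec) \<Rightarrow> bool" where
  "orthonormal n m v \<longleftrightarrow> (\<forall>i<m. v i \<in> carrier_vec n) \<and>
     (\<forall>i<m. \<forall>j<m. v i \<bullet>c v j = (if i = j then 1 else 0))"

definition frame_mat :: "nat \<Rightarrow> nat \<Rightarrow> (nat \<Rightarrow> complex vec) \<Rightarrow> complex mat" where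
  "frame_mat n m v = mat n m (\<lambda>(r, j). v j $ r)"

lemma frame_mat_carrier [simp]: "frame_mat n m v \<in> carrier_mat n m"
  by (simp add: frame_mat_def)

lemma frame_mat_dim [simp]: "dim_row (frame_mat n m v) = n" "dim_col (frame_mat n m v) = m"
  by (simp_all add: frame_mat_def)

lemma frame_mat_index: "r < n \<Longrightarrow> j < m \<Longrightarrow> frame_mat n m v $$ (r, j) = v j $ r"
  by (simp add: frame_mat_def)

lemma col_frame_mat: "v j \<in> carrier_vec n \<Longrightarrow> j < m \<Longrightarrow> col (frame_mat n m v) j = v j"
  by (intro eq_vecI) (auto simp: frame_mat_def)

lemma adjoint_frame_mat_mult_vec:
  assumes "j < m" "v j \<in> carrier_vec n" "x \<in> carrier_vec n"
  shows "(mat_adjoint (frame_mat n m v) *\<^sub>v x) $ j = x \<bullet>c v j"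
  using assms mat_adjoint_carrier[OF frame_mat_carrier[of n m v]]
  by (auto simp: scalar_prod_def mat_adjoint_index[OF frame_mat_carrier] frame_mat_index
      mult.commute intro!: sum.cong)

lemma frame_mat_isometry:
  assumes "orthonormal n m v"
  shows "mat_adjoint (frame_mat n m v) * frame_mat n m v = 1\<^sub>m m"
proof (rule eq_matI)
  note c = mat_adjoint_carrier[OF frame_mat_carrier[of n m v]]
  fix i j assume "i < dim_row (1\<^sub>m m :: complex mat)" "j < dim_col (1\<^sub>m m :: complex mat)"
  then have ij: "i < m" "j < m" by auto
  have "(mat_adjoint (frame_mat n m v) * frame_mat n m v) $$ (i, j)
      = (mat_adjoint (frame_mat n m v) *\<^sub>v col (frame_mat n m v) j) $ i"
    using ij c by simp
  also have "\<dots> = v j \<bullet>c v i"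
    using ij assms by (simp add: col_frame_mat adjoint_frame_mat_mult_vec orthonormal_def)
  also have "\<dots> = 1\<^sub>m m $$ (i, j)" using ij assms by (auto simp: orthonormal_def)
  finally show "(mat_adjoint (frame_mat n m v) * frame_mat n m v) $$ (i, j) = 1\<^sub>m m $$ (i, j)" .
qed (use mat_adjoint_carrier[OF frame_mat_carrier[of n m v]] in auto)

lemma frame_mat_unitary:
  assumes "orthonormal n n v"
  shows "unitary_mat (frame_mat n n v)"
  using frame_mat_isometry[OF assms] mat_mult_left_right_inverse[OF
      mat_adjoint_carrier[OF frame_mat_carrier] frame_mat_carrier frame_mat_isometry[OF assms]]
  by (simp add: unitary_mat_def)

text \<open>For a square isometry \<open>P\<close> also \<open>P P\<^sup>* = 1\<close>, and the inner products are the entries of \<open>P\<^sup>* x\<close>.\<close>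
lemma orthonormal_basis_separates:
  assumes v: "orthonormal n n v" and x: "x \<in> carrier_vec n" and 0: "\<And>j. j < n \<Longrightarrow> x \<bullet>c v j = 0"
  shows "x = 0\<^sub>v n"
proof -
  let ?P = "frame_mat n n v"
  note c = mat_adjoint_carrier[OF frame_mat_carrier[of n n v]]
  have "mat_adjoint ?P *\<^sub>v x = 0\<^sub>v n"
    by (rule eq_vecI) (use v x 0 c in \<open>auto simp: adjoint_frame_mat_mult_vec orthonormal_def
        simp del: index_mult_mat_vec\<close>)
  then have "?P *\<^sub>v (mat_adjoint ?P *\<^sub>v x) = 0\<^sub>v n" by auto
  moreover have "?P *\<^sub>v (mat_adjoint ?P *\<^sub>v x) = (?P * mat_adjoint ?P) *\<^sub>v x"
    using c x by (simp add: assoc_mult_mat_vec[of _ n n _ n])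
  ultimately show ?thesis using frame_mat_unitary[OF v] x by (simp add: unitary_mat_def)
qed

lemma orthonormal_append:
  assumes v: "orthonormal n m v" and x: "x \<in> carrier_vec n" "x \<noteq> 0\<^sub>v n"
    and orth: "\<And>i. i < m \<Longrightarrow> x \<bullet>c v i = 0"
  obtains c where "orthonormal n (Suc m) (v(m := c \<cdot>\<^sub>v x))"
proof
  define s where "s = x \<bullet>c x"
  have s: "s > 0" using x by (simp add: s_def conjugate_square_greater_0_vec)
  then have s': "s = of_real (Re s)" "Re s > 0" by (auto simp: less_complex_def complex_eq_iff)
  define c where "c = complex_of_real (1 / sqrt (Re s))"
  have "c * cnj c * s = of_real ((1 / sqrt (Re s))\<^sup>2 * Re s)"
    by (subst s'(1)) (simp add: c_def power2_eq_square flip: of_real_mult)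
  also have "\<dots> = 1" using s' by (simp add: power_divide)
  finally have c: "c * (cnj c * s) = 1" by (simp add: mult.assoc)
  have xx: "(c \<cdot>\<^sub>v x) \<bullet>c (c \<cdot>\<^sub>v x) = 1"
    using x c by (simp add: s_def conjugate_smult_vec mult_ac)
  have xv: "(c \<cdot>\<^sub>v x) \<bullet>c v i = 0" if "i < m" for i
    using that orth v x by (simp add: orthonormal_def)
  have vx: "v i \<bullet>c (c \<cdot>\<^sub>v x) = 0" if "i < m" for i
  proof -
    have "v i \<in> carrier_vec n" using v that by (simp add: orthonormal_def)
    then have "v i \<bullet>c (c \<cdot>\<^sub>v x) = cnj ((c \<cdot>\<^sub>v x) \<bullet>c v i)"
      using x by (auto simp: scalar_prod_def mult_ac intro!: sum.cong)
    then show ?thesis using xv that by simp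
  qed
  show "orthonormal n (Suc m) (v(m := c \<cdot>\<^sub>v x))"
    using v x xx xv vx by (auto simp: orthonormal_def less_Suc_eq)
qed

text \<open>As long as \<open>m < n\<close>, the \<open>m\<close> orthogonality conditions have a common nonzero solution.\<close>
lemma orthonormal_extend:
  assumes "orthonormal n m v" "m \<le> n"
  obtains w where "orthonormal n n w" "\<And>i. i < m \<Longrightarrow> w i = v i"
proof -
  from assms(2) have "\<exists>w. orthonormal n n w \<and> (\<forall>i<m. w i = v i)"
    using assms(1)
  proof (induction m arbitrary: v rule: inc_induct)
    case base
    then show ?case by auto
  next
    case (step m)
    note c = mat_adjoint_carrier[OF frame_mat_carrier[of n m v]]
    obtain x where x: "x \<in> carrier_vec n" "x \<noteq> 0\<^sub>v n" "mat_adjoint (frame_mat n m v) *\<^sub>v x = 0\<^sub>v m"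
      using homogeneous_system_nontrivial[OF c step.hyps(2)] by blast
    have "x \<bullet>c v i = 0" if "i < m" for i
      using adjoint_frame_mat_mult_vec[of i m v n x] that x step.prems by (simp add: orthonormal_def)
    then obtain a where "orthonormal n (Suc m) (v(m := a \<cdot>\<^sub>v x))"
      using orthonormal_append[OF step.prems x(1,2)] by blast
    from step.IH[OF this] show ?case by (metis fun_upd_apply less_SucI nat_neq_iff)
  qed
  then show ?thesis using that by blast
qed

section \<open>Eigenbases of Hermitian matrices\<close>

text \<open>
  The orthogonal complement of the eigenvectors found so far is invariant under \<open>H\<close>. An isometry
  \<open>Z\<close> onto it compresses \<open>H\<close> to the smaller matrix \<open>Z\<^sup>* H Z\<close>, and \<open>Z\<close> maps an eigenvector of the
  compression to one of \<open>H\<close>.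
\<close>
lemma hermitian_next_eigenvector:
  assumes H: "H \<in> carrier_mat n n" and herm: "mat_adjoint H = H"
    and v: "orthonormal n m v" and m: "m < n"
    and ev: "\<And>i. i < m \<Longrightarrow> H *\<^sub>v v i = e i \<cdot>\<^sub>v v i"
  obtains x c where "x \<in> carrier_vec n" "x \<noteq> 0\<^sub>v n" "\<And>i. i < m \<Longrightarrow> x \<bullet>c v i = 0"
    "H *\<^sub>v x = c \<cdot>\<^sub>v x"
proof -
  obtain w where w: "orthonormal n n w" and wv: "\<And>i. i < m \<Longrightarrow> w i = v i"
    using orthonormal_extend[OF v] m by auto
  define Z where "Z = frame_mat n (n - m) (\<lambda>j. w (m + j))"
  define N where "N = mat_adjoint Z * (H * Z)"
  have Z: "Z \<in> carrier_mat n (n - m)" by (simp add: Z_def)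
  note Z' = mat_adjoint_carrier[OF Z]
  have N: "N \<in> carrier_mat (n - m) (n - m)" using Z Z' H by (auto simp: N_def)
  have wc: "w i \<in> carrier_vec n" if "i < n" for i using w that by (simp add: orthonormal_def)
  have ZZ: "mat_adjoint Z * Z = 1\<^sub>m (n - m)" unfolding Z_def
    by (rule frame_mat_isometry) (use w in \<open>auto simp: orthonormal_def\<close>)
  have Zx: "(mat_adjoint Z *\<^sub>v x) $ j = x \<bullet>c w (m + j)" if "j < n - m" "x \<in> carrier_vec n" for x j
    using that wc by (simp add: Z_def adjoint_frame_mat_mult_vec)
  have "degree (char_poly N) = n - m" using degree_monic_char_poly[OF N] by simp
  then have "\<not> constant (poly (char_poly N))" using m by (simp add: constant_degree)
  then obtain c where "poly (char_poly N) c = 0" using fundamental_theorem_of_algebra by blast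
  then have "eigenvalue N c" using eigenvalue_root_char_poly[OF N] by simp
  then obtain y where y: "y \<in> carrier_vec (n - m)" "y \<noteq> 0\<^sub>v (n - m)" and Ny: "N *\<^sub>v y = c \<cdot>\<^sub>v y"
    using N by (auto simp: eigenvalue_def eigenvector_def)
  define x where "x = Z *\<^sub>v y"
  have x: "x \<in> carrier_vec n" using Z y by (simp add: x_def)
  have Hx: "H *\<^sub>v x \<in> carrier_vec n" using H x by simp
  have y_x: "mat_adjoint Z *\<^sub>v x = y"
    using Z Z' y ZZ by (simp add: x_def flip: assoc_mult_mat_vec[of _ "n - m" n _ "n - m"])
  have N_x: "mat_adjoint Z *\<^sub>v (H *\<^sub>v x) = c \<cdot>\<^sub>v y"
    using Ny Z Z' H y assoc_mult_mat_vec[OF Z' mult_carrier_mat[OF H Z] y(1)]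
    by (simp add: N_def x_def assoc_mult_mat_vec[OF H Z y(1)])
  have x0: "x \<noteq> 0\<^sub>v n" using y_x y Z' by auto
  have orth: "x \<bullet>c v i = 0" if i: "i < m" for i
  proof -
    have "mat_adjoint Z *\<^sub>v w i = 0\<^sub>v (n - m)"
      by (rule eq_vecI)
        (use i m w Z' wc in \<open>auto simp: Zx orthonormal_def simp del: index_mult_mat_vec\<close>)
    then have "x \<bullet>c w i = y \<bullet>c 0\<^sub>v (n - m)"
      unfolding x_def using mat_adjoint_scalar_prod_right[OF Z y(1) wc[of i]] i m by simp
    then show ?thesis using i y by (simp add: wv)
  qed
  \<comment> \<open>The compression determines the components of \<open>H x\<close> along the complement; those along the
    known eigenvectors vanish because \<open>H\<close> is self-adjoint and \<open>x\<close> is orthogonal to them.\<close>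
  have zero: "H *\<^sub>v x - c \<cdot>\<^sub>v x = 0\<^sub>v n"
  proof (rule orthonormal_basis_separates[OF w])
    fix l assume l: "l < n"
    have "(H *\<^sub>v x) \<bullet>c w l = c * (x \<bullet>c w l)"
    proof (cases "l < m")
      case True
      have "(H *\<^sub>v x) \<bullet>c w l = x \<bullet>c (H *\<^sub>v w l)"
        using mat_adjoint_scalar_prod_right[OF H x wc[OF l]] by (simp add: herm)
      also have "\<dots> = 0" using True x wc[OF l] orth by (simp add: wv ev conjugate_smult_vec)
      finally show ?thesis using orth True by (simp add: wv)
    next
      case False
      then obtain j where j: "l = m + j" "j < n - m" using l
        by (metis add_diff_inverse_nat diff_less_mono not_less)
      then show ?thesis using Zx[OF j(2) Hx] Zx[OF j(2) x] y by (simp add: N_x y_x)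
    qed
    then show "(H *\<^sub>v x - c \<cdot>\<^sub>v x) \<bullet>c w l = 0"
      using Hx x wc[OF l] by (simp add: minus_scalar_prod_distrib[of _ n])
  qed (use Hx x in simp)
  have "H *\<^sub>v x = c \<cdot>\<^sub>v x"
  proof (rule eq_vecI)
    fix i assume "i < dim_vec (c \<cdot>\<^sub>v x)"
    then have i: "i < n" using x by simp
    have "(H *\<^sub>v x - c \<cdot>\<^sub>v x) $ i = 0" using zero i by simp
    then show "(H *\<^sub>v x) $ i = (c \<cdot>\<^sub>v x) $ i" using i x H by simp
  qed (use H x in simp)
  then show ?thesis using that x x0 orth by blast
qed

lemma hermitian_eigenbasis:
  assumes H: "H \<in> carrier_mat n n" and herm: "mat_adjoint H = H"
  obtains v e where "orthonormal n n v" "\<And>i. i < n \<Longrightarrow> H *\<^sub>v v i = e i \<cdot>\<^sub>v v i"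
proof -
  have "\<exists>v e. orthonormal n m v \<and> (\<forall>i<m. H *\<^sub>v v i = e i \<cdot>\<^sub>v v i)" if "m \<le> n" for m
    using that
  proof (induction m)
    case 0
    show ?case by (simp add: orthonormal_def)
  next
    case (Suc m)
    then obtain v e where v: "orthonormal n m v" and ev: "\<forall>i<m. H *\<^sub>v v i = e i \<cdot>\<^sub>v v i" by auto
    obtain x c where x: "x \<in> carrier_vec n" "x \<noteq> 0\<^sub>v n" "\<And>i. i < m \<Longrightarrow> x \<bullet>c v i = 0"
      and Hx: "H *\<^sub>v x = c \<cdot>\<^sub>v x"
      using hermitian_next_eigenvector[OF H herm v] Suc.prems ev by (metis Suc_le_eq)
    obtain a where a: "orthonormal n (Suc m) (v(m := a \<cdot>\<^sub>v x))"
      using orthonormal_append[OF v x] by blast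
    have "H *\<^sub>v (v(m := a \<cdot>\<^sub>v x)) i = (e(m := c)) i \<cdot>\<^sub>v (v(m := a \<cdot>\<^sub>v x)) i" if "i < Suc m" for i
      using that ev H x
      by (auto simp: less_Suc_eq mult_mat_vec[of _ n n] Hx smult_smult_assoc mult.commute)
    with a show ?case by blast
  qed
  from this[of n] that show ?thesis by blast
qed

lemma mult_eigenframe:
  assumes H: "H \<in> carrier_mat n n" and v: "\<And>i. i < m \<Longrightarrow> v i \<in> carrier_vec n"
    and ev: "\<And>i. i < m \<Longrightarrow> H *\<^sub>v v i = e i \<cdot>\<^sub>v v i"
  shows "H * frame_mat n m v = frame_mat n m v * mat_diag m e"
proof (rule mat_col_eqI)
  note P = frame_mat_carrier[of n m v]
  fix j assume "j < dim_col (frame_mat n m v * mat_diag m e)"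
  then have j: "j < m" by (simp add: mat_diag_mult_right[OF P])
  have "col (frame_mat n m v * mat_diag m e) j = e j \<cdot>\<^sub>v v j"
    using j v[OF j] by (intro eq_vecI) (simp_all add: mat_diag_mult_right[OF P] frame_mat_index)
  then show "col (H * frame_mat n m v) j = col (frame_mat n m v * mat_diag m e) j"
    using col_mult2[OF H P j] ev[OF j] v[OF j] j by (simp add: col_frame_mat)
qed (use H in \<open>auto simp: mat_diag_mult_right[OF frame_mat_carrier]\<close>)

text \<open>Unitary diagonalisation preserves the characteristic polynomial, hence algebraic multiplicities.\<close>
lemma char_poly_eigenbasis:
  assumes H: "H \<in> carrier_mat n n" and v: "orthonormal n n v"
    and ev: "\<And>i. i < n \<Longrightarrow> H *\<^sub>v v i = e i \<cdot>\<^sub>v v i"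
  shows "proots (char_poly H) = mset (map e [0..<n])"
proof -
  define P where "P = frame_mat n n v"
  define D where "D = mat_diag n e"
  have P: "P \<in> carrier_mat n n" and D: "D \<in> carrier_mat n n" by (simp_all add: P_def D_def)
  note P' = mat_adjoint_carrier[OF P]
  have U: "mat_adjoint P * P = 1\<^sub>m n" "P * mat_adjoint P = 1\<^sub>m n"
    using frame_mat_unitary[OF v] by (simp_all add: unitary_mat_def P_def)
  have HP: "H * P = P * D" unfolding P_def D_def
    by (rule mult_eigenframe[OF H]) (use v ev in \<open>simp_all add: orthonormal_def\<close>)
  have "H = H * (P * mat_adjoint P)" using H by (simp add: U)
  also have "\<dots> = P * D * mat_adjoint P"
    using H P P' by (simp add: HP flip: assoc_mult_mat[of _ n n _ n _ n])
  finally have "similar_mat H D" using H D P P' U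
    by (intro similar_matI[of _ _ P "mat_adjoint P" n]) auto
  then have "char_poly H = char_poly D" by (rule char_poly_similar)
  also have "\<dots> = (\<Prod>a\<leftarrow>diag_mat D. [:- a, 1:])"
    by (rule char_poly_upper_triangular[OF D]) (auto simp: D_def mat_diag_def)
  also have "diag_mat D = map e [0..<n]" by (auto simp: D_def mat_diag_def diag_mat_def)
  finally have "char_poly H = (\<Prod>a\<leftarrow>map e [0..<n]. [:- a, 1:])" .
  moreover have "proots (\<Prod>a\<leftarrow>as. [:- a, 1:]) = mset as" for as :: "complex list"
  proof (induction as)
    case (Cons a as)
    have "(\<Prod>a\<leftarrow>as. [:- a, 1:]) \<noteq> 0" by (auto simp: prod_list_zero_iff)
    then have "proots ([:- a, 1:] * (\<Prod>a\<leftarrow>as. [:- a, 1:])) = {#a#} + mset as"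
      using Cons.IH by (subst proots_mult) auto
    then show ?case by simp
  qed simp
  ultimately show ?thesis by metis
qed

text \<open>
  Sorting the eigenvalues turns the two counting conditions on singular values into inequalities
  at fixed positions.
\<close>
lemma gram_eigenbasis:
  assumes A: "A \<in> carrier_mat n n"
  obtains v \<mu> where "orthonormal n n v"
    "\<And>i. i < n \<Longrightarrow> (mat_adjoint A * A) *\<^sub>v v i = complex_of_real (\<mu> i) \<cdot>\<^sub>v v i"
    "\<And>i j. i \<le> j \<Longrightarrow> j < n \<Longrightarrow> \<mu> i \<le> \<mu> j"
    "singular_values A = image_mset (\<lambda>i. sqrt (\<mu> i)) (mset [0..<n])"
proof -
  note A' = mat_adjoint_carrier[OF A]
  define H where "H = mat_adjoint A * A"
  have H: "H \<in> carrier_mat n n" using A A' by (simp add: H_def)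
  have herm: "mat_adjoint H = H"
    by (simp add: H_def mat_adjoint_mult[OF A' A] mat_adjoint_adjoint[OF A])
  obtain u e where u: "orthonormal n n u" and ev: "\<And>i. i < n \<Longrightarrow> H *\<^sub>v u i = e i \<cdot>\<^sub>v u i"
    using hermitian_eigenbasis[OF H herm] by blast
  note pr = char_poly_eigenbasis[OF H u ev]
  have e: "e i = complex_of_real (Re (e i))" if "i < n" for i
  proof -
    have "e i \<in># proots (char_poly H)" using that by (simp add: pr)
    then have "e i \<in> \<real>" using char_poly_gram_root(1)[OF A] by (simp add: H_def)
    then show ?thesis by (simp add: of_real_Re)
  qed
  define xs where "xs = sort_key (\<lambda>i. Re (e i)) [0..<n]"
  have xs: "length xs = n" "set xs = {..<n}" "distinct xs" "mset xs = mset [0..<n]"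
    "sorted (map (\<lambda>i. Re (e i)) xs)"
    by (auto simp: xs_def)
  have lt: "xs ! i < n" if "i < n" for i using xs that by (metis lessThan_iff nth_mem)
  show ?thesis
  proof (rule that[of "\<lambda>i. u (xs ! i)" "\<lambda>i. Re (e (xs ! i))"])
    show "orthonormal n n (\<lambda>i. u (xs ! i))"
      using u lt xs by (auto simp: orthonormal_def nth_eq_iff_index_eq)
    show "(mat_adjoint A * A) *\<^sub>v u (xs ! i) = complex_of_real (Re (e (xs ! i))) \<cdot>\<^sub>v u (xs ! i)"
      if "i < n" for i
      using ev[OF lt[OF that]] e[OF lt[OF that]] by (simp add: H_def)
    show "Re (e (xs ! i)) \<le> Re (e (xs ! j))" if "i \<le> j" "j < n" for i j
      using sorted_nth_mono[OF xs(5), of i j] that xs(1) by simp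
    have "map ((!) xs) [0..<n] = xs" using xs(1) map_nth by blast
    then have "image_mset (\<lambda>i. sqrt (Re (e (xs ! i)))) (mset [0..<n])
        = image_mset (\<lambda>i. sqrt (Re (e i))) (mset xs)"
      by (metis (no_types, lifting) ext comp_apply image_mset.comp mset_map multiset.map_comp)
    also have "\<dots> = singular_values A"
      by (simp add: singular_values_def xs(4) pr multiset.map_comp comp_def flip: H_def)
    finally show "singular_values A = image_mset (\<lambda>i. sqrt (Re (e (xs ! i)))) (mset [0..<n])" ..
  qed
qed

section \<open>Eigenvalues of the Gram matrix of a perturbed unitary matrix\<close>

lemma isometry_scalar_prod:
  fixes P :: "complex mat"
  assumes P: "P \<in> carrier_mat n m" "mat_adjoint P * P = 1\<^sub>m m"
    and a: "a \<in> carrier_vec m" and b: "b \<in> carrier_vec m"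
  shows "(P *\<^sub>v a) \<bullet>c (P *\<^sub>v b) = a \<bullet>c b"
proof -
  have "(P *\<^sub>v a) \<bullet>c (P *\<^sub>v b) = a \<bullet>c (mat_adjoint P *\<^sub>v (P *\<^sub>v b))"
    using mat_adjoint_scalar_prod_right[OF P(1) a, of "P *\<^sub>v b"] P b by simp
  also have "mat_adjoint P *\<^sub>v (P *\<^sub>v b) = b"
    using assoc_mult_mat_vec[OF mat_adjoint_carrier[OF P(1)] P(1) b] P b by simp
  finally show ?thesis .
qed

text \<open>
  The span of \<open>p > k\<close> eigenvectors contains a nonzero \<open>x\<close> with \<open>B\<^sup>* x = 0\<close>. There \<open>A\<close> acts as \<open>Q\<close>
  and preserves the norm; with \<open>z\<close> the coordinates of \<open>x\<close>, the sum is the difference between the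
  squared norms of \<open>A x\<close> and \<open>x\<close>.
\<close>
lemma low_rank_perturbation_balance:
  fixes \<mu> :: "nat \<Rightarrow> real"
  assumes A: "A \<in> carrier_mat n n" and U: "A \<in> unitary_plus_rank n k" and kp: "k < p"
    and u: "orthonormal n p u"
    and ev: "\<And>j. j < p \<Longrightarrow> (mat_adjoint A * A) *\<^sub>v u j = complex_of_real (\<mu> j) \<cdot>\<^sub>v u j"
  obtains z where "z \<in> carrier_vec p" "z \<noteq> 0\<^sub>v p" "(\<Sum>j<p. (\<mu> j - 1) * (cmod (z $ j))\<^sup>2) = 0"
proof -
  obtain Q G B where Q: "Q \<in> carrier_mat n n" "unitary_mat Q" and G: "G \<in> carrier_mat n k"
    and B: "B \<in> carrier_mat n k" and AQ: "A = Q + G * mat_adjoint B"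
    using U by (auto simp: unitary_plus_rank_def)
  define P where "P = frame_mat n p u"
  define D where "D = mat_diag p (\<lambda>j. complex_of_real (\<mu> j))"
  have P: "P \<in> carrier_mat n p" and PP: "mat_adjoint P * P = 1\<^sub>m p"
    using frame_mat_isometry[OF u] by (simp_all add: P_def)
  have D: "D \<in> carrier_mat p p" by (simp add: D_def)
  note A' = mat_adjoint_carrier[OF A] and B' = mat_adjoint_carrier[OF B]
  have BP: "mat_adjoint B * P \<in> carrier_mat k p" using B' P by simp
  obtain z where z: "z \<in> carrier_vec p" "z \<noteq> 0\<^sub>v p" and "(mat_adjoint B * P) *\<^sub>v z = 0\<^sub>v k"
    using homogeneous_system_nontrivial[OF BP kp] by blast
  then have Bz: "mat_adjoint B *\<^sub>v (P *\<^sub>v z) = 0\<^sub>v k" using assoc_mult_mat_vec[OF B' P z(1)] by simp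
  have x: "P *\<^sub>v z \<in> carrier_vec n" using P z by simp
  have "A *\<^sub>v (P *\<^sub>v z) = Q *\<^sub>v (P *\<^sub>v z) + (G * mat_adjoint B) *\<^sub>v (P *\<^sub>v z)"
    unfolding AQ by (rule add_mult_distrib_mat_vec[OF Q(1) _ x]) (use G B' in simp)
  also have "\<dots> = Q *\<^sub>v (P *\<^sub>v z)"
    using assoc_mult_mat_vec[OF G B' x] Bz G Q x by auto
  finally have AQx: "A *\<^sub>v (P *\<^sub>v z) = Q *\<^sub>v (P *\<^sub>v z)" .
  have "z \<bullet>c z = (Q *\<^sub>v (P *\<^sub>v z)) \<bullet>c (Q *\<^sub>v (P *\<^sub>v z))"
    using isometry_scalar_prod[OF Q(1) _ x x] isometry_scalar_prod[OF P PP z(1) z(1)] Q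
    by (auto simp: unitary_mat_def)
  also have "\<dots> = (A *\<^sub>v (P *\<^sub>v z)) \<bullet>c (A *\<^sub>v (P *\<^sub>v z))" by (simp add: AQx)
  also have "\<dots> = (P *\<^sub>v z) \<bullet>c (mat_adjoint A *\<^sub>v (A *\<^sub>v (P *\<^sub>v z)))"
    using mat_adjoint_scalar_prod_right[OF A x] A x by simp
  also have "mat_adjoint A *\<^sub>v (A *\<^sub>v (P *\<^sub>v z)) = (mat_adjoint A * A * P) *\<^sub>v z"
    using A A' P z x assoc_mult_mat_vec[OF A' A x]
      assoc_mult_mat_vec[OF mult_carrier_mat[OF A' A] P z(1)] by simp
  also have "mat_adjoint A * A * P = P * D" unfolding P_def D_def
    by (rule mult_eigenframe) (use A A' u ev in \<open>auto simp: orthonormal_def\<close>)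
  also have "(P * D) *\<^sub>v z = P *\<^sub>v (D *\<^sub>v z)" by (rule assoc_mult_mat_vec[OF P D z(1)])
  also have "(P *\<^sub>v z) \<bullet>c (P *\<^sub>v (D *\<^sub>v z)) = z \<bullet>c (D *\<^sub>v z)"
    using isometry_scalar_prod[OF P PP z(1)] D z by simp
  finally have eq: "z \<bullet>c z = z \<bullet>c (D *\<^sub>v z)" .
  have Dz: "(D *\<^sub>v z) $ j = complex_of_real (\<mu> j) * z $ j" if "j < p" for j
  proof -
    have "(D *\<^sub>v z) $ j = (\<Sum>i\<in>{0..<p}. (if j = i then complex_of_real (\<mu> i) else 0) * z $ i)"
      using that z by (simp add: D_def mat_diag_def scalar_prod_def)
    also have "\<dots> = (\<Sum>i\<in>{0..<p}. if i = j then complex_of_real (\<mu> j) * z $ j else 0)"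
      by (intro sum.cong) auto
    finally have "(D *\<^sub>v z) $ j = (\<Sum>i\<in>{0..<p}. if i = j then complex_of_real (\<mu> j) * z $ j else 0)" .
    then show ?thesis using that by simp
  qed
  have "complex_of_real (\<Sum>j<p. (\<mu> j - 1) * (cmod (z $ j))\<^sup>2)
      = (\<Sum>j<p. z $ j * cnj (of_real (\<mu> j) * z $ j)) - (\<Sum>j<p. z $ j * cnj (z $ j))"
    by (simp add: sum_subtractf[symmetric] algebra_simps complex_norm_square flip: of_real_power)
  also have "\<dots> = z \<bullet>c (D *\<^sub>v z) - z \<bullet>c z"
    using z(1) D Dz by (auto simp: scalar_prod_def lessThan_atLeast0 simp del: index_mult_mat_vec
        intro!: arg_cong2[of _ _ _ _ "(-)"] sum.cong)
  also have "\<dots> = 0" by (simp add: eq)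
  finally have "(\<Sum>j<p. (\<mu> j - 1) * (cmod (z $ j))\<^sup>2) = 0" using of_real_eq_0_iff by blast
  with z show ?thesis using that by blast
qed

text \<open>Otherwise the balance would be a sum of terms of one sign, not all zero.\<close>
lemma unitary_plus_rank_eigenvalues:
  fixes \<mu> :: "nat \<Rightarrow> real"
  assumes A: "A \<in> carrier_mat n n" and U: "A \<in> unitary_plus_rank n k" and kp: "k < p"
    and u: "orthonormal n p u"
    and ev: "\<And>j. j < p \<Longrightarrow> (mat_adjoint A * A) *\<^sub>v u j = complex_of_real (\<mu> j) \<cdot>\<^sub>v u j"
  shows "\<exists>j<p. \<mu> j \<le> 1" "\<exists>j<p. \<mu> j \<ge> 1"
proof -
  obtain z where z: "z \<in> carrier_vec p" "z \<noteq> 0\<^sub>v p"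
    and sum: "(\<Sum>j<p. (\<mu> j - 1) * (cmod (z $ j))\<^sup>2) = 0"
    using low_rank_perturbation_balance[OF A U kp u ev] by blast
  obtain l where l: "l < p" "z $ l \<noteq> 0" using z by (metis carrier_vecD eq_vecI index_zero_vec)
  show "\<exists>j<p. \<mu> j \<le> 1"
  proof (rule ccontr)
    assume "\<not> ?thesis"
    then have "\<And>j. j < p \<Longrightarrow> \<mu> j > 1" by force
    then have "(\<Sum>j<p. (\<mu> j - 1) * (cmod (z $ j))\<^sup>2) > 0"
      using l by (intro sum_pos2[of _ l]) (auto intro!: mult_nonneg_nonneg mult_pos_pos intro: less_imp_le)
    with sum show False by simp
  qed
  show "\<exists>j<p. \<mu> j \<ge> 1"
  proof (rule ccontr)
    assume "\<not> ?thesis"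
    then have "\<And>j. j < p \<Longrightarrow> \<mu> j < 1" by force
    then have "(\<Sum>j<p. (1 - \<mu> j) * (cmod (z $ j))\<^sup>2) > 0"
      using l by (intro sum_pos2[of _ l]) (auto intro!: mult_nonneg_nonneg mult_pos_pos intro: less_imp_le)
    moreover have "(\<Sum>j<p. (1 - \<mu> j) * (cmod (z $ j))\<^sup>2) = - (\<Sum>j<p. (\<mu> j - 1) * (cmod (z $ j))\<^sup>2)"
      by (simp add: sum_negf[symmetric] algebra_simps)
    ultimately show False using sum by simp
  qed
qed

section \<open>Unitary plus low rank from an isometric subspace\<close>

text \<open>
  Completing the family and its image to bases, with matrices \<open>P\<close> and \<open>R\<close>, yields the unitary
  \<open>Q = R P\<^sup>*\<close>. The first \<open>m\<close> columns of \<open>(A - Q) P = A P - R\<close> vanish, so multiplying by \<open>P\<^sup>*\<close> uses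
  only its last \<open>n - m\<close> columns, and those of \<open>P\<close>.
\<close>
lemma unitary_plus_rank_if_isometric_on:
  assumes A: "A \<in> carrier_mat n n" and m: "m \<le> n"
    and u: "orthonormal n m u" and Au: "orthonormal n m (\<lambda>i. A *\<^sub>v u i)"
  shows "A \<in> unitary_plus_rank n (n - m)"
proof -
  obtain w where w: "orthonormal n n w" and wu: "\<And>i. i < m \<Longrightarrow> w i = u i"
    using orthonormal_extend[OF u m] by blast
  obtain r where r: "orthonormal n n r" and ru: "\<And>i. i < m \<Longrightarrow> r i = A *\<^sub>v u i"
    using orthonormal_extend[OF Au m] by blast
  define P where "P = frame_mat n n w"
  define R where "R = frame_mat n n r"
  have P: "P \<in> carrier_mat n n" "unitary_mat P" and R: "R \<in> carrier_mat n n" "unitary_mat R"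
    using frame_mat_unitary w r by (auto simp: P_def R_def)
  note P' = mat_adjoint_carrier[OF P(1)]
  define N where "N = A * P - R"
  have N: "N \<in> carrier_mat n n" unfolding N_def by (rule minus_carrier_mat[OF R(1)])
  have N0: "N $$ (i, j) = 0" if "i < n" "j < m" for i j
  proof -
    have jn: "j < n" using that m by simp
    have "(A * P) $$ (i, j) = (A *\<^sub>v col P j) $ i" using that jn A P by simp
    also have "col P j = w j" using jn w by (simp add: P_def col_frame_mat orthonormal_def)
    also have "(A *\<^sub>v w j) $ i = R $$ (i, j)"
      using that jn by (simp add: R_def frame_mat_index ru wu)
    finally show ?thesis using that jn A P R by (simp add: N_def)
  qed
  define G where "G = mat n (n - m) (\<lambda>(i, j). N $$ (i, m + j))"
  define B where "B = mat n (n - m) (\<lambda>(i, j). P $$ (i, m + j))"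
  have G: "G \<in> carrier_mat n (n - m)" and B: "B \<in> carrier_mat n (n - m)"
    by (simp_all add: G_def B_def)
  note B' = mat_adjoint_carrier[OF B]
  have "N * mat_adjoint P = G * mat_adjoint B"
  proof (rule eq_matI)
    fix i c assume "i < dim_row (G * mat_adjoint B)" "c < dim_col (G * mat_adjoint B)"
    then have ic: "i < n" "c < n" using G B' by auto
    have "(N * mat_adjoint P) $$ (i, c) = (\<Sum>l\<in>{0..<n}. N $$ (i, l) * cnj (P $$ (c, l)))"
      using ic N P(1) P' by (auto simp: scalar_prod_def mat_adjoint_index[OF P(1)] intro!: sum.cong)
    also have "\<dots> = (\<Sum>l\<in>{m..<n}. N $$ (i, l) * cnj (P $$ (c, l)))"
      using ic m N0 by (intro sum.mono_neutral_right) auto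
    also have "\<dots> = (\<Sum>j\<in>{0..<n - m}. N $$ (i, m + j) * cnj (P $$ (c, m + j)))"
      by (subst sum.atLeastLessThan_shift_0) (simp add: add.commute)
    also have "\<dots> = (G * mat_adjoint B) $$ (i, c)"
      using ic G B B' by (auto simp: scalar_prod_def mat_adjoint_index[OF B] intro!: sum.cong)
        (simp add: G_def B_def)
    finally show "(N * mat_adjoint P) $$ (i, c) = (G * mat_adjoint B) $$ (i, c)" .
  qed (use N P' G B' in auto)
  moreover have "R * mat_adjoint P + N * mat_adjoint P = A"
  proof -
    have "R + N = A * P" using A P R by (intro eq_matI) (auto simp: N_def)
    then have "R * mat_adjoint P + N * mat_adjoint P = A * P * mat_adjoint P"
      using add_mult_distrib_mat[OF R(1) N P'] by simp
    also have "\<dots> = A" using A P P' by (simp add: assoc_mult_mat[OF A P(1) P'] unitary_mat_def)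
    finally show ?thesis .
  qed
  moreover have "unitary_mat (R * mat_adjoint P)"
    by (rule unitary_mat_mult[OF R P' unitary_mat_adjoint[OF P]])
  ultimately show ?thesis using G B R P' unfolding unitary_plus_rank_def
    by (intro CollectI exI[of _ "R * mat_adjoint P"] exI[of _ G] exI[of _ B]) auto
qed

section \<open>Isotropic combinations of paired eigenvectors\<close>

text \<open>
  The geometric content: between two orthonormal eigenvectors of \<open>A\<^sup>* A\<close> with eigenvalues \<open>s\<close> and
  \<open>t\<close> there is a unit vector whose image under \<open>A\<close> is again a unit vector.
\<close>
lemma convex_combination_to_one:
  fixes s t :: real
  assumes "s \<le> 1" "1 \<le> t"
  obtains a b where "a\<^sup>2 + b\<^sup>2 = 1" "a\<^sup>2 * s + b\<^sup>2 * t = 1"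
proof (cases "s = t")
  \<comment> \<open>The weights are quotients by \<open>t - s\<close>; if it is zero, both numbers are \<open>1\<close>.\<close>
  case True
  with assms show ?thesis by (intro that[of 1 0]) auto
next
  case False
  then have d: "t - s > 0" using assms by simp
  have "(t - 1) / (t - s) + (1 - s) / (t - s) = (t - s) / (t - s)"
    by (simp add: add_divide_distrib[symmetric])
  moreover have "(t - 1) / (t - s) * s + (1 - s) / (t - s) * t = (t - s) / (t - s)"
    by (simp add: add_divide_distrib[symmetric] algebra_simps)
  ultimately show ?thesis using d assms
    by (intro that[of "sqrt ((t - 1) / (t - s))" "sqrt ((1 - s) / (t - s))"]) simp_all
qed

text \<open>
  Used twice: for the eigenvectors themselves, with \<open>c = 1\<close>, and for their images under \<open>A\<close>, with
  \<open>c\<close> the eigenvalues of \<open>A\<^sup>* A\<close>. The bounds keep the partners \<open>i + l\<close> for \<open>i < h\<close> apart from the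
  first \<open>m\<close> indices, so that distinct combinations share no \<open>f i\<close>.
\<close>
lemma orthonormal_pair_combinations:
  fixes c a b :: "nat \<Rightarrow> real"
  assumes f: "\<And>i. i < n \<Longrightarrow> f i \<in> carrier_vec d"
    and orth: "\<And>i j. i < n \<Longrightarrow> j < n \<Longrightarrow> f i \<bullet>c f j = (if i = j then complex_of_real (c i) else 0)"
    and le: "h \<le> m" "m \<le> l" "h + l \<le> n" "m \<le> n"
    and pair: "\<And>i. i < h \<Longrightarrow> (a i)\<^sup>2 * c i + (b i)\<^sup>2 * c (i + l) = 1"
    and single: "\<And>i. h \<le> i \<Longrightarrow> i < m \<Longrightarrow> c i = 1"
  shows "orthonormal d m (\<lambda>i. if i < h
    then complex_of_real (a i) \<cdot>\<^sub>v f i + complex_of_real (b i) \<cdot>\<^sub>v f (i + l) else f i)"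
proof -
  have fc: "f i \<in> carrier_vec d" "f i \<bullet>c f i = complex_of_real (c i)" if "i < m" for i
    using f orth that le by auto
  have fl: "f (i + l) \<in> carrier_vec d" "f (i + l) \<bullet>c f (i + l) = complex_of_real (c (i + l))"
    if "i < h" for i
    using f orth that le by auto
  have o1: "f i \<bullet>c f j = 0" if "i < m" "j < m" "i \<noteq> j" for i j using orth that le by auto
  have o2: "f (i + l) \<bullet>c f (j + l) = 0" if "i < h" "j < h" "i \<noteq> j" for i j using orth that le by auto
  have o3: "f i \<bullet>c f (j + l) = 0" "f (j + l) \<bullet>c f i = 0" if "i < m" "j < h" for i j
    using orth[of i "j + l"] orth[of "j + l" i] that le by auto
  have sq: "complex_of_real (a i) * (of_real (a i) * of_real (c i))
      + complex_of_real (b i) * (of_real (b i) * of_real (c (i + l))) = 1" if "i < h" for i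
    using arg_cong[OF pair[OF that], of complex_of_real] by (simp add: power2_eq_square mult.assoc)
  show ?thesis unfolding orthonormal_def
    using fc fl o1 o2 o3 sq single le(1)
    by (auto simp: scalar_prod_add_distrib[of _ d] add_scalar_prod_distrib[of _ d]
        smult_scalar_prod_distrib[of _ d] scalar_prod_smult_distrib[of _ d]
        conjugate_add_vec[of _ d] conjugate_smult_vec)
qed

section \<open>Characterisation by singular values\<close>

theorem theorem3:
  fixes A :: "complex mat" and n k :: nat
  assumes "A \<in> carrier_mat n n"
    and "k \<le> n"
  shows "A \<in> unitary_plus_rank n k \<longleftrightarrow>
    size (filter_mset (\<lambda>s. s > 1) (singular_values A)) \<le> k \<and>
    size (filter_mset (\<lambda>s. s < 1) (singular_values A)) \<le> k"
proof -
  note A = assms(1)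
  obtain v \<mu> where v: "orthonormal n n v"
    and ev: "\<And>i. i < n \<Longrightarrow> (mat_adjoint A * A) *\<^sub>v v i = complex_of_real (\<mu> i) \<cdot>\<^sub>v v i"
    and mono: "\<And>i j. i \<le> j \<Longrightarrow> j < n \<Longrightarrow> \<mu> i \<le> \<mu> j"
    and sv: "singular_values A = image_mset (\<lambda>i. sqrt (\<mu> i)) (mset [0..<n])"
    using gram_eigenbasis[OF A] by blast
  have size: "size (filter_mset p (singular_values A)) = card {i. i < n \<and> p (sqrt (\<mu> i))}" for p
    by (simp add: sv filter_mset_image_mset filter_mset_mset_set)
  have large: "card {i. i < n \<and> sqrt (\<mu> i) > 1} \<le> k \<longleftrightarrow> (\<forall>i<n - k. \<mu> i \<le> 1)"
  proof
    assume c: "card {i. i < n \<and> sqrt (\<mu> i) > 1} \<le> k"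
    show "\<forall>i<n - k. \<mu> i \<le> 1"
    proof (intro allI impI, rule ccontr)
      fix i assume i: "i < n - k" "\<not> \<mu> i \<le> 1"
      then have "{i..<n} \<subseteq> {i. i < n \<and> sqrt (\<mu> i) > 1}" using mono by fastforce
      from card_mono[OF _ this] c i show False by simp
    qed
  next
    assume "\<forall>i<n - k. \<mu> i \<le> 1"
    then have "{i. i < n \<and> sqrt (\<mu> i) > 1} \<subseteq> {n - k..<n}" by (auto simp: not_less[symmetric])
    from card_mono[OF _ this] show "card {i. i < n \<and> sqrt (\<mu> i) > 1} \<le> k" using assms(2) by simp
  qed
  have small: "card {i. i < n \<and> sqrt (\<mu> i) < 1} \<le> k \<longleftrightarrow> (\<forall>i. k \<le> i \<and> i < n \<longrightarrow> 1 \<le> \<mu> i)"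
  proof
    assume c: "card {i. i < n \<and> sqrt (\<mu> i) < 1} \<le> k"
    show "\<forall>i. k \<le> i \<and> i < n \<longrightarrow> 1 \<le> \<mu> i"
    proof (intro allI impI, rule ccontr)
      fix i assume i: "k \<le> i \<and> i < n" "\<not> 1 \<le> \<mu> i"
      then have "{..i} \<subseteq> {i. i < n \<and> sqrt (\<mu> i) < 1}" using mono by fastforce
      from card_mono[OF _ this] c i show False by simp
    qed
  next
    assume "\<forall>i. k \<le> i \<and> i < n \<longrightarrow> 1 \<le> \<mu> i"
    then have "{i. i < n \<and> sqrt (\<mu> i) < 1} \<subseteq> {..<k}" by (auto simp: not_le[symmetric])
    from card_mono[OF _ this] show "card {i. i < n \<and> sqrt (\<mu> i) < 1} \<le> k" by simp
  qed
  have vc: "v i \<in> carrier_vec n" if "i < n" for i using v that by (simp add: orthonormal_def)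
  have "A \<in> unitary_plus_rank n k \<longleftrightarrow> (\<forall>i<n - k. \<mu> i \<le> 1) \<and> (\<forall>i. k \<le> i \<and> i < n \<longrightarrow> 1 \<le> \<mu> i)"
  proof
    assume U: "A \<in> unitary_plus_rank n k"
    show "(\<forall>i<n - k. \<mu> i \<le> 1) \<and> (\<forall>i. k \<le> i \<and> i < n \<longrightarrow> 1 \<le> \<mu> i)"
    proof (intro conjI allI impI)
      fix i assume i: "i < n - k"
      \<comment> \<open>The eigenvectors from \<open>i\<close> on are more than \<open>k\<close> in number.\<close>
      have "\<exists>j<n - i. \<mu> (i + j) \<le> 1"
        by (rule unitary_plus_rank_eigenvalues(1)[OF A U, of _ "\<lambda>j. v (i + j)"])
          (use i v ev in \<open>auto simp: orthonormal_def\<close>)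
      then obtain j where j: "i + j < n" "\<mu> (i + j) \<le> 1" by (auto simp: less_diff_conv add.commute)
      then show "\<mu> i \<le> 1" using mono[of i "i + j"] by simp
    next
      fix i assume i: "k \<le> i \<and> i < n"
      have "\<exists>j<Suc i. \<mu> j \<ge> 1"
        by (rule unitary_plus_rank_eigenvalues(2)[OF A U, of _ v])
          (use i v ev in \<open>auto simp: orthonormal_def\<close>)
      then obtain j where "j \<le> i" "\<mu> j \<ge> 1" by (auto simp: less_Suc_eq_le)
      then show "1 \<le> \<mu> i" using mono[of j i] i by simp
    qed
  next
    assume "(\<forall>i<n - k. \<mu> i \<le> 1) \<and> (\<forall>i. k \<le> i \<and> i < n \<longrightarrow> 1 \<le> \<mu> i)"
    then have lo: "\<And>i. i < n - k \<Longrightarrow> \<mu> i \<le> 1" and hi: "\<And>i. k \<le> i \<Longrightarrow> i < n \<Longrightarrow> 1 \<le> \<mu> i"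
      by auto
    \<comment> \<open>If \<open>k < n - k\<close>, the indices from \<open>k\<close> up to \<open>n - k\<close> carry the eigenvalue \<open>1\<close> and stay
      unpaired; the shift \<open>l\<close> leads past them. Otherwise all \<open>n - k\<close> indices are paired.\<close>
    define m where "m = n - k"
    define h where "h = min k m"
    define l where "l = max k m"
    have le: "h \<le> m" "m \<le> l" "h + l \<le> n" "m \<le> n" "h \<le> k" "k \<le> l"
      using assms(2) by (auto simp: h_def l_def m_def)
    have "\<exists>a b. a\<^sup>2 + b\<^sup>2 = 1 \<and> a\<^sup>2 * \<mu> i + b\<^sup>2 * \<mu> (i + l) = 1" if "i < h" for i
    proof -
      have "i < n - k" "k \<le> i + l" "i + l < n" using that le by (auto simp: m_def)
      then show ?thesis using convex_combination_to_one[OF lo hi] by blast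
    qed
    then obtain a b where ab: "\<And>i. i < h \<Longrightarrow> (a i)\<^sup>2 + (b i)\<^sup>2 = 1"
      "\<And>i. i < h \<Longrightarrow> (a i)\<^sup>2 * \<mu> i + (b i)\<^sup>2 * \<mu> (i + l) = 1"
      by metis
    define comb where "comb f i = (if i < h
      then complex_of_real (a i) \<cdot>\<^sub>v f i + complex_of_real (b i) \<cdot>\<^sub>v f (i + l) else f i)"
      for f :: "nat \<Rightarrow> complex vec" and i
    have u: "orthonormal n m (comb v)" unfolding comb_def
      by (rule orthonormal_pair_combinations[where n = n and c = "\<lambda>_. 1"])
        (use v ab le in \<open>auto simp: orthonormal_def\<close>)
    have Av: "(A *\<^sub>v v i) \<bullet>c (A *\<^sub>v v j) = (if i = j then complex_of_real (\<mu> i) else 0)"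
      if ij: "i < n" "j < n" for i j
    proof -
      have "(A *\<^sub>v v i) \<bullet>c (A *\<^sub>v v j) = (mat_adjoint A *\<^sub>v (A *\<^sub>v v i)) \<bullet>c v j"
        using mat_adjoint_scalar_prod[OF A vc[OF ij(2)], of "A *\<^sub>v v i"] A vc[OF ij(1)] by simp
      also have "\<dots> = (complex_of_real (\<mu> i) \<cdot>\<^sub>v v i) \<bullet>c v j"
        using ev[OF ij(1)] assoc_mult_mat_vec[OF mat_adjoint_carrier[OF A] A vc[OF ij(1)]] by simp
      also have "\<dots> = (if i = j then complex_of_real (\<mu> i) else 0)"
        using v ij vc by (simp add: orthonormal_def smult_scalar_prod_distrib[of _ n])
      finally show ?thesis .
    qed
    have "\<mu> i = 1" if "h \<le> i" "i < m" for i
      using lo[of i] hi[of i] that by (auto simp: h_def m_def)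
    then have "orthonormal n m (comb (\<lambda>i. A *\<^sub>v v i))" unfolding comb_def
      by (intro orthonormal_pair_combinations[where n = n and c = \<mu>])
        (use Av ab le A vc in auto)
    moreover have "A *\<^sub>v comb v i = comb (\<lambda>i. A *\<^sub>v v i) i" if "i < m" for i
      using that le A vc
      by (simp add: comb_def mult_add_distrib_mat_vec[of _ n n] mult_mat_vec[of _ n n])
    ultimately have "orthonormal n m (\<lambda>i. A *\<^sub>v comb v i)" by (simp add: orthonormal_def)
    then have "A \<in> unitary_plus_rank n (n - m)"
      by (rule unitary_plus_rank_if_isometric_on[OF A le(4) u])
    then show "A \<in> unitary_plus_rank n k" using assms(2) by (simp add: m_def)
  qed
  then show ?thesis by (simp only: size large small)
qed

end
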